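(* Let $!_{a}$ be an abstract factorial. Then there is a sequence of positive integers $(h_n)_{n\ge 0}$ with $h_0=1$ and $n!_{a}=n!\,h_n$ for all $n\in\mathbb{N}$, such that for each $n\in\mathbb{N}$, $$h_k\,h_{n-k}\ \Big|\ h_n\binom{n}{k},\qquad k=0,1,2,\dots,n. \qquad ( * )$$ Conversely, if $(h_n)_{n\ge 0}$ is a sequence of positive integers satisfying $h_0=1$ and $( * )$ for each $n\in\mathbb{N}$, then the function $!_{a}:\mathbb{N}\to\mathbb{Z}^+$ defined by $n!_{a}=n!\,h_n$ is an abstract factorial.
   Context: $\mathbb{N}=\{0,1,2,\dots\}$ and $\mathbb{Z}^+=\{1,2,3,\dots\}$; $n!$ and $\binom{n}{k}$ denote the ordinary factorial and binomial coefficient. An abstract factorial is a function $!_{a}:\mathbb{N}\to\mathbb{Z}^+$, $n\mapsto n!_{a}$, such that: (1) $0!_{a}=1$; (2) for all integers $0\le k\le n$, the generalized binomial coefficient $\binom{n}{k}_{a}:=\frac{n!_{a}}{k!_{a}\,(n-k)!_{a}}$ is a positive integer; (3) for every positive integer $n$, $n!$ divides $n!_{a}$. *)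

theory Defs
  imports Complex_Main
begin

text \<open>
  The quotient is taken in the rationals, so that integrality of the generalized binomial
  coefficient is a genuine condition; it is only meant for \<open>k \<le> n\<close>, as \<open>n - k\<close> is truncated.
\<close>

definition gen_binomial :: "(nat \<Rightarrow> nat) \<Rightarrow> nat \<Rightarrow> nat \<Rightarrow> rat" where
  "gen_binomial f n k = of_nat (f n) / (of_nat (f k) * of_nat (f (n - k)))"

text \<open>
  The codomain of positive integers is rendered by the first conjunct.
\<close>

definition abstract_factorial :: "(nat \<Rightarrow> nat) \<Rightarrow> bool" where
  "abstract_factorial f \<longleftrightarrow>
     (\<forall>n. f n > 0) \<and>
     f 0 = 1 \<and>
     (\<forall>n k. k \<le> n \<longrightarrow> gen_binomial f n k \<in> \<int> \<and> gen_binomial f n k > 0) \<and>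
     (\<forall>n>0. fact n dvd f n)"

end

theory Submission
  imports Defs
begin

text \<open>Divisibility of \<open>f n\<close> by n! means that f factors as n! times a sequence
  \<open>h\<close>. In the quotient of \<open>f n\<close> by \<open>f k * f (n - k)\<close> the
  ordinary factorials then collect into \<open>n choose k\<close>, leaving
  \<open>h n * (n choose k)\<close> over \<open>h k * h (n - k)\<close>
  (\<open>gen_binomial_fact_mult\<close>). Integrality of this fraction is exactly the required
  divisibility. For positive \<open>h\<close> this gives the equivalence
  \<open>abstract_factorial_fact_mult_iff\<close>, from which both halves of the theorem are read
  off.\<close>

lemma of_nat_divide_in_Ints_iff:
  assumes "b > 0"
  shows "(of_nat a / of_nat b :: rat) \<in> \<int> \<longleftrightarrow> b dvd a"
proof
  assume "(of_nat a / of_nat b :: rat) \<in> \<int>"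
  then obtain z where "of_nat a / of_nat b = (of_int z :: rat)"
    by (auto elim: Ints_cases)
  with assms have "(of_int (int a) :: rat) = of_int (z * int b)"
    by (simp add: field_simps)
  then have "int a = z * int b"
    by (simp only: of_int_eq_iff)
  then show "b dvd a"
    by (metis dvd_triv_right int_dvd_int_iff)
next
  assume "b dvd a"
  with assms show "(of_nat a / of_nat b :: rat) \<in> \<int>"
    by (auto elim!: dvdE)
qed

lemma gen_binomial_fact_mult:
  assumes "k \<le> n"
  shows "gen_binomial (\<lambda>n. fact n * h n) n k
         = of_nat (h n * (n choose k)) / of_nat (h k * h (n - k))"
  using assms by (simp add: gen_binomial_def binomial_fact field_simps)

text \<open>The product form already supplies positivity and divisibility by n!, and since 0! = 1
  the normalisation at 0 becomes \<open>h 0 = 1\<close>. What remains is integrality of the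
  generalized binomials, translated for each pair \<open>k \<le> n\<close>.\<close>

lemma abstract_factorial_fact_mult_iff:
  assumes "\<And>n. h n > 0"
  shows "abstract_factorial (\<lambda>n. fact n * h n)
         \<longleftrightarrow> h 0 = 1 \<and> (\<forall>n. \<forall>k\<le>n. h k * h (n - k) dvd h n * (n choose k))"
proof -
  have "gen_binomial (\<lambda>n. fact n * h n) n k \<in> \<int> \<and> gen_binomial (\<lambda>n. fact n * h n) n k > 0
        \<longleftrightarrow> h k * h (n - k) dvd h n * (n choose k)" if "k \<le> n" for n k
  proof -
    have "gen_binomial (\<lambda>n. fact n * h n) n k > 0"
      using assms by (simp add: gen_binomial_def)
    moreover have "gen_binomial (\<lambda>n. fact n * h n) n k \<in> \<int>
        \<longleftrightarrow> h k * h (n - k) dvd h n * (n choose k)"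
      unfolding gen_binomial_fact_mult[OF that]
      by (rule of_nat_divide_in_Ints_iff) (simp add: assms)
    ultimately show ?thesis by blast
  qed
  with assms show ?thesis
    by (auto simp: abstract_factorial_def)
qed

theorem proposition4:
  shows "(\<forall>f :: nat \<Rightarrow> nat. abstract_factorial f \<longrightarrow>
            (\<exists>h :: nat \<Rightarrow> nat. (\<forall>n. h n > 0) \<and> h 0 = 1 \<and> (\<forall>n. f n = fact n * h n) \<and>
               (\<forall>n. \<forall>k\<le>n. h k * h (n - k) dvd h n * (n choose k))))
       \<and> (\<forall>h :: nat \<Rightarrow> nat. (\<forall>n. h n > 0) \<and> h 0 = 1 \<and>
               (\<forall>n. \<forall>k\<le>n. h k * h (n - k) dvd h n * (n choose k)) \<longrightarrow>
            abstract_factorial (\<lambda>n. fact n * h n))"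
proof (intro conjI allI impI)
  fix f :: "nat \<Rightarrow> nat"
  assume f: "abstract_factorial f"
  define h where "h n = f n div fact n" for n
  have "fact n dvd f n" for n
    \<comment> \<open>The definition gives divisibility only for positive \<open>n\<close>; at 0 it
      holds because 0! = 1.\<close>
    using f by (cases "n = 0") (auto simp: abstract_factorial_def)
  then have fh: "f n = fact n * h n" for n
    by (simp add: h_def)
  have pos: "h n > 0" for n
    \<comment> \<open>If \<open>h n\<close> were 0, then \<open>f n\<close> would be 0 as
      well.\<close>
    using f fh[of n] by (metis abstract_factorial_def mult_0_right not_gr_zero)
  \<comment> \<open>This function is \<open>f\<close> itself, rewritten into the shape to which the
    equivalence applies.\<close>
  have "abstract_factorial (\<lambda>n. fact n * h n)"
    using f by (simp flip: fh)
  with pos fh show "\<exists>h. (\<forall>n. h n > 0) \<and> h 0 = 1 \<and> (\<forall>n. f n = fact n * h n) \<and>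
      (\<forall>n. \<forall>k\<le>n. h k * h (n - k) dvd h n * (n choose k))"
    using abstract_factorial_fact_mult_iff by blast
next
  fix h :: "nat \<Rightarrow> nat"
  assume "(\<forall>n. h n > 0) \<and> h 0 = 1 \<and> (\<forall>n. \<forall>k\<le>n. h k * h (n - k) dvd h n * (n choose k))"
  then show "abstract_factorial (\<lambda>n. fact n * h n)"
    by (simp add: abstract_factorial_fact_mult_iff)
qed

end
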